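(* Let $X$ and $Y$ be compact Hausdorff spaces. Suppose that $\Phi:C(X)_+^{\mathrm{sp}}\to C(Y)_+^{\mathrm{sp}}$ is a metric preserving bijection, i.e. a bijection with $\|\Phi(f)-\Phi(g)\|=\|f-g\|$ for all $f,g\in C(X)_+^{\mathrm{sp}}$. Then $\Phi$ can be extended uniquely to a $^*$-isomorphism from $C(X)$ onto $C(Y)$. More precisely, there is a homeomorphism $\sigma:Y\to X$ such that $\Phi(f)=f\circ\sigma$ for all $f\in C(X)_+^{\mathrm{sp}}$.
   Context: $C(X)$ is the $C^*$-algebra of continuous complex-valued functions on $X$ with the supremum norm, and $C(X)_+^{\mathrm{sp}}:=\{f\in C(X): f\geq 0,\ \|f\|=1\}$. *)

theory Defs
  imports "HOL-Analysis.Analysis"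
begin

text \<open>
  A space is a topology on an arbitrary carrier set, so that the empty space is
  included. Elements of \<open>C(X)\<close> take the value \<open>undefined\<close> off the carrier; thus HOL
  equality of two elements is equality of functions on \<open>X\<close>, and the pointwise
  operations have to be restricted to the carrier.
\<close>

definition cont_fun :: "'a topology \<Rightarrow> ('a \<Rightarrow> complex) set" where
  "cont_fun X = {f \<in> extensional (topspace X). continuous_map X euclidean f}"

text \<open>The supremum of the empty set of reals is unspecified, hence the case distinction.\<close>

definition sup_norm :: "'a topology \<Rightarrow> ('a \<Rightarrow> complex) \<Rightarrow> real" where
  "sup_norm X f = (if topspace X = {} then 0 else (SUP x\<in>topspace X. norm (f x)))"

definition pos_sphere :: "'a topology \<Rightarrow> ('a \<Rightarrow> complex) set" where
  "pos_sphere X = {f \<in> cont_fun X. (\<forall>x\<in>topspace X. f x \<in> \<real>\<^sub>\<ge>\<^sub>0) \<and> sup_norm X f = 1}"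

definition star_isomorphism ::
  "'a topology \<Rightarrow> 'b topology \<Rightarrow> (('a \<Rightarrow> complex) \<Rightarrow> ('b \<Rightarrow> complex)) \<Rightarrow> bool" where
  "star_isomorphism X Y T \<longleftrightarrow>
     bij_betw T (cont_fun X) (cont_fun Y) \<and>
     (\<forall>f\<in>cont_fun X. \<forall>g\<in>cont_fun X.
        T (\<lambda>x\<in>topspace X. f x + g x) = (\<lambda>y\<in>topspace Y. T f y + T g y)) \<and>
     (\<forall>c. \<forall>f\<in>cont_fun X.
        T (\<lambda>x\<in>topspace X. c * f x) = (\<lambda>y\<in>topspace Y. c * T f y)) \<and>
     (\<forall>f\<in>cont_fun X. \<forall>g\<in>cont_fun X.
        T (\<lambda>x\<in>topspace X. f x * g x) = (\<lambda>y\<in>topspace Y. T f y * T g y)) \<and>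
     (\<forall>f\<in>cont_fun X.
        T (\<lambda>x\<in>topspace X. cnj (f x)) = (\<lambda>y\<in>topspace Y. cnj (T f y)))"

lemma cont_fun_eq_mspace_cfunspace:
  assumes "compact_space X"
  shows "cont_fun X = mspace (cfunspace X euclidean_metric)"
  using compactin_mspace_cfunspace[of X "euclidean_metric :: complex metric"] assms
  by (auto simp: cont_fun_def compact_space_def extensional_def)

lemma sup_norm_diff_eq_mdist_cfunspace:
  assumes "compact_space X" "f \<in> cont_fun X" "g \<in> cont_fun X"
  shows "sup_norm X (\<lambda>x. f x - g x) = mdist (cfunspace X euclidean_metric) f g"
proof -
  have "f \<in> mspace (funspace (topspace X) euclidean_metric)"
    "g \<in> mspace (funspace (topspace X) euclidean_metric)"
    using assms cfunspace_subset_funspace[of X "euclidean_metric :: complex metric"]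
    by (auto simp only: cont_fun_eq_mspace_cfunspace)
  then show ?thesis
    by (simp add: sup_norm_def mdist_cfunspace_eq_mdist_funspace dist_norm
        Metric_space.fdist_def[OF Met_TC.Metric_space_axioms])
qed

end

theory Submission
  imports Defs
begin

text \<open>
  The constant function \<open>1\<close> has a purely metric characterisation in the positive sphere,
  so \<open>\<Phi>\<close> fixes it and preserves invertibility (distance from \<open>1\<close> other than \<open>1\<close>).
  For invertible \<open>f\<close>, the set of \<open>g\<close> at distance \<open>1\<close> from \<open>f\<close> determines the peak set
  \<open>{f = 1}\<close>, so \<open>\<Phi>\<close> preserves the inclusion order of these peak sets. By compactness,
  every \<open>y\<close> then has an \<open>x\<close> at which \<open>f\<close> peaks whenever \<open>\<Phi> f\<close> peaks at \<open>y\<close>, and comparing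
  \<open>f\<close> with \<open>min 1 (f + 1 - s)\<close> upgrades this to \<open>\<Phi> f y \<le> f x\<close> for all \<open>f\<close>. Going back
  with the inverse of \<open>\<Phi>\<close> yields \<open>f x \<le> \<Phi> f y'\<close>; since points are separated, \<open>y = y'\<close>
  and equality holds.
\<close>

subsection \<open>Continuous functions on compact spaces\<close>

lemma continuous_map_compose_continuous:
  assumes "continuous_map X euclidean f" "continuous_on UNIV h"
  shows "continuous_map X euclidean (\<lambda>x. h (f x))"
  using continuous_map_compose[OF assms(1), of euclidean h] assms(2)
  by (simp add: o_def)

lemma continuous_map_Re:
  "continuous_map X euclidean f \<Longrightarrow> continuous_map X euclideanreal (\<lambda>x. Re (f x))"
  by (simp add: continuous_map_atin tendsto_Re)

lemma continuous_map_Im: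
  "continuous_map X euclidean f \<Longrightarrow> continuous_map X euclideanreal (\<lambda>x. Im (f x))"
  by (simp add: continuous_map_atin tendsto_Im)

lemma compact_space_attains_sup:
  fixes u :: "'a \<Rightarrow> real"
  assumes "compact_space X" "topspace X \<noteq> {}" "continuous_map X euclideanreal u"
  obtains x where "x \<in> topspace X" "\<And>y. y \<in> topspace X \<Longrightarrow> u y \<le> u x"
proof -
  have "compact (u ` topspace X)"
    using image_compactin[OF _ assms(3), of "topspace X"] assms(1)
    by (simp add: compact_space_def)
  then show ?thesis
    using compact_attains_sup[of "u ` topspace X"] assms(2) that by auto
qed

lemma sup_norm_eqI:
  assumes "x \<in> topspace X" "\<And>y. y \<in> topspace X \<Longrightarrow> norm (f y) \<le> norm (f x)"
  shows "sup_norm X f = norm (f x)"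
proof -
  have "(SUP x\<in>topspace X. norm (f x)) = norm (f x)"
    using assms by (intro cSup_eq_maximum) auto
  then show ?thesis
    using assms by (auto simp: sup_norm_def)
qed

lemma sup_norm_attained:
  assumes "compact_space X" "topspace X \<noteq> {}" "continuous_map X euclidean f"
  obtains x where "x \<in> topspace X" "sup_norm X f = norm (f x)"
    "\<And>y. y \<in> topspace X \<Longrightarrow> norm (f y) \<le> norm (f x)"
proof -
  have "continuous_map X euclideanreal (\<lambda>x. norm (f x))"
    by (rule continuous_map_norm[OF assms(3)])
  then obtain x where "x \<in> topspace X"
    "\<And>y. y \<in> topspace X \<Longrightarrow> norm (f y) \<le> norm (f x)"
    using compact_space_attains_sup[OF assms(1,2), of "\<lambda>x. norm (f x)"] by blast
  then show ?thesis
    using that[of x] sup_norm_eqI[of x X f] by simp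
qed

lemma cont_fun_eqI:
  assumes "f \<in> cont_fun X" "g \<in> cont_fun X" "\<And>x. x \<in> topspace X \<Longrightarrow> f x = g x"
  shows "f = g"
  using assms by (auto simp: cont_fun_def intro: extensionalityI)

lemma restrict_in_cont_fun:
  assumes "continuous_map X euclidean f"
  shows "(\<lambda>x\<in>topspace X. f x) \<in> cont_fun X"
  using continuous_map_eq[OF assms, of "\<lambda>x\<in>topspace X. f x"] by (simp add: cont_fun_def)

lemma cont_fun_add:
  assumes "f \<in> cont_fun X" "g \<in> cont_fun X"
  shows "(\<lambda>x\<in>topspace X. f x + g x) \<in> cont_fun X"
  using assms by (intro restrict_in_cont_fun continuous_map_add) (simp_all add: cont_fun_def)

lemma cont_fun_mult:
  assumes "f \<in> cont_fun X" "g \<in> cont_fun X"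
  shows "(\<lambda>x\<in>topspace X. f x * g x) \<in> cont_fun X"
  using assms by (intro restrict_in_cont_fun) (simp add: cont_fun_def continuous_map_atin tendsto_mult)

lemma cont_fun_scale:
  assumes "f \<in> cont_fun X"
  shows "(\<lambda>x\<in>topspace X. c * f x) \<in> cont_fun X"
  using assms
  by (intro restrict_in_cont_fun) (simp add: cont_fun_def continuous_map_atin tendsto_mult_left)

lemma cont_fun_cnj:
  assumes "f \<in> cont_fun X"
  shows "(\<lambda>x\<in>topspace X. cnj (f x)) \<in> cont_fun X"
  using assms by (intro restrict_in_cont_fun) (simp add: cont_fun_def continuous_map_atin tendsto_cnj)

text \<open>\<open>C\<close> may be empty, which happens in the continuity proof of the point map
  when the open set there is the whole space.\<close>

lemma Urysohn_compact_Hausdorff: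
  assumes "compact_space X" "Hausdorff_space X" "closedin X C" "x \<in> topspace X" "x \<notin> C"
  obtains u :: "'a \<Rightarrow> real" where "continuous_map X euclideanreal u"
    "\<And>z. z \<in> topspace X \<Longrightarrow> 0 \<le> u z \<and> u z \<le> 1" "u x = 0" "\<And>z. z \<in> C \<Longrightarrow> u z = 1"
proof -
  have "normal_space X" "closedin X {x}" "disjnt {x} C"
    using assms by (auto simp: compact_Hausdorff_or_regular_imp_normal_space
        closedin_Hausdorff_singleton disjnt_iff)
  then obtain u where u: "continuous_map X (top_of_set {0..1::real}) u" "u ` {x} \<subseteq> {0}" "u ` C \<subseteq> {1}"
    using Urysohn_lemma[of X "{x}" C 0 1] assms(3) by auto
  then have "\<And>z. z \<in> topspace X \<Longrightarrow> u z \<in> {0..1}"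
    by (auto simp: continuous_map_in_subtopology)
  with u show ?thesis
    using that[of u] by (auto simp: continuous_map_in_subtopology)
qed

subsection \<open>The positive sphere\<close>

text \<open>Test functions are built as real functions; the restriction gives them the value off the
  carrier that \<open>cont_fun\<close> demands.\<close>

definition lift_real :: "'a topology \<Rightarrow> ('a \<Rightarrow> real) \<Rightarrow> 'a \<Rightarrow> complex" where
  "lift_real X u = (\<lambda>x\<in>topspace X. complex_of_real (u x))"

lemma Re_lift_real [simp]: "x \<in> topspace X \<Longrightarrow> Re (lift_real X u x) = u x"
  by (simp add: lift_real_def)

lemma lift_real_in_pos_sphere:
  assumes "continuous_map X euclideanreal u"
    and "\<And>x. x \<in> topspace X \<Longrightarrow> 0 \<le> u x \<and> u x \<le> 1"
    and "x \<in> topspace X" "u x = 1"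
  shows "lift_real X u \<in> pos_sphere X"
proof -
  have "continuous_map X euclidean (\<lambda>x. complex_of_real (u x))"
    by (rule continuous_map_compose_continuous[OF assms(1)]) (intro continuous_intros)
  moreover have "sup_norm X (lift_real X u) = norm (lift_real X u x)"
    using assms by (intro sup_norm_eqI) (auto simp: lift_real_def)
  ultimately show ?thesis
    using assms restrict_in_cont_fun
    by (auto simp: pos_sphere_def lift_real_def complex_nonneg_Reals_iff)
qed

lemma pos_sphere_cont_fun: "f \<in> pos_sphere X \<Longrightarrow> f \<in> cont_fun X"
  by (simp add: pos_sphere_def)

lemma pos_sphere_continuous:
  assumes "f \<in> pos_sphere X"
  shows "continuous_map X euclideanreal (\<lambda>x. Re (f x))"
  using assms by (intro continuous_map_Re) (simp add: pos_sphere_def cont_fun_def)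

lemma pos_sphere_Im:
  assumes "f \<in> pos_sphere X" "x \<in> topspace X"
  shows "Im (f x) = 0"
  using assms by (auto simp: pos_sphere_def complex_nonneg_Reals_iff)

lemma pos_sphere_of_real:
  assumes "f \<in> pos_sphere X" "x \<in> topspace X"
  shows "f x = complex_of_real (Re (f x))"
  using pos_sphere_Im[OF assms] by (simp add: complex_eq_iff)

text \<open>By its case distinction \<open>sup_norm\<close> is 0 on the empty space, never
  1.\<close>

lemma pos_sphere_topspace: "f \<in> pos_sphere X \<Longrightarrow> topspace X \<noteq> {}"
  by (auto simp: pos_sphere_def sup_norm_def)

lemma pos_sphere_nonneg:
  assumes "f \<in> pos_sphere X" "x \<in> topspace X"
  shows "0 \<le> Re (f x)"
  using assms by (auto simp: pos_sphere_def complex_nonneg_Reals_iff)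

text \<open>On a compact space a continuous function without zeros is invertible, so these are the
  invertible elements of the sphere.\<close>

definition inv_pos_sphere :: "'a topology \<Rightarrow> ('a \<Rightarrow> complex) set" where
  "inv_pos_sphere X = {f \<in> pos_sphere X. \<forall>x\<in>topspace X. Re (f x) \<noteq> 0}"

context
  fixes X :: "'a topology"
  assumes compact: "compact_space X"
begin

section \<open>Maxima and distances in the sphere\<close>

lemma pos_sphere_Max:
  assumes "f \<in> pos_sphere X"
  obtains x where "x \<in> topspace X" "Re (f x) = 1" "\<And>y. y \<in> topspace X \<Longrightarrow> Re (f y) \<le> 1"
proof -
  have cont: "continuous_map X euclidean f" and norm: "sup_norm X f = 1"
    using assms by (auto simp: pos_sphere_def cont_fun_def)
  obtain x where x: "x \<in> topspace X" "norm (f x) = 1"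
    "\<And>y. y \<in> topspace X \<Longrightarrow> norm (f y) \<le> 1"
    using sup_norm_attained[OF compact pos_sphere_topspace[OF assms] cont] norm by auto
  have "norm (f y) = Re (f y)" if "y \<in> topspace X" for y
    using pos_sphere_Im[OF assms that] pos_sphere_nonneg[OF assms that] by (simp add: cmod_eq_Re)
  with x that[of x] show ?thesis by simp
qed

lemma pos_sphere_le_1:
  assumes "f \<in> pos_sphere X" "x \<in> topspace X"
  shows "Re (f x) \<le> 1"
  using assms by (blast elim: pos_sphere_Max)

lemma pos_sphere_peak:
  assumes "f \<in> pos_sphere X"
  obtains x where "x \<in> topspace X" "Re (f x) = 1"
  using assms by (blast elim: pos_sphere_Max)

text \<open>Compactness turns the supremum into a maximum and the imaginary parts vanish, so
  distances become differences of reals at a single point.\<close>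

lemma pos_sphere_dist_attained:
  assumes "f \<in> pos_sphere X" "g \<in> pos_sphere X"
  obtains x where "x \<in> topspace X" "sup_norm X (\<lambda>x. f x - g x) = \<bar>Re (f x) - Re (g x)\<bar>"
    "\<And>y. y \<in> topspace X \<Longrightarrow> \<bar>Re (f y) - Re (g y)\<bar> \<le> \<bar>Re (f x) - Re (g x)\<bar>"
proof -
  have cont: "continuous_map X euclidean (\<lambda>x. f x - g x)"
    using assms by (auto simp: pos_sphere_def cont_fun_def intro: continuous_map_diff)
  obtain x where "x \<in> topspace X" "sup_norm X (\<lambda>x. f x - g x) = norm (f x - g x)"
    "\<And>y. y \<in> topspace X \<Longrightarrow> norm (f y - g y) \<le> norm (f x - g x)"
    using sup_norm_attained[OF compact pos_sphere_topspace[OF assms(1)] cont] by blast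
  moreover have "norm (f y - g y) = \<bar>Re (f y) - Re (g y)\<bar>" if "y \<in> topspace X" for y
    using assms[THEN pos_sphere_Im, OF that] by (simp add: cmod_eq_Re)
  ultimately show ?thesis using that[of x] by simp
qed

lemma pos_sphere_dist_le_iff:
  assumes "f \<in> pos_sphere X" "g \<in> pos_sphere X"
  shows "sup_norm X (\<lambda>x. f x - g x) \<le> r \<longleftrightarrow> (\<forall>x\<in>topspace X. \<bar>Re (f x) - Re (g x)\<bar> \<le> r)"
proof -
  obtain x where "x \<in> topspace X" "sup_norm X (\<lambda>x. f x - g x) = \<bar>Re (f x) - Re (g x)\<bar>"
    "\<And>y. y \<in> topspace X \<Longrightarrow> \<bar>Re (f y) - Re (g y)\<bar> \<le> \<bar>Re (f x) - Re (g x)\<bar>"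
    using pos_sphere_dist_attained[OF assms] by blast
  then show ?thesis by fastforce
qed

lemma pos_sphere_diff_le:
  assumes "f \<in> pos_sphere X" "g \<in> pos_sphere X" "sup_norm X (\<lambda>x. f x - g x) \<le> r"
    "x \<in> topspace X"
  shows "\<bar>Re (f x) - Re (g x)\<bar> \<le> r"
  using assms(3,4) pos_sphere_dist_le_iff[OF assms(1,2)] by blast

text \<open>All values lie in [0, 1], and two such numbers differ by 1 only if they are the two
  endpoints.\<close>

lemma pos_sphere_dist_eq_1_iff:
  assumes "f \<in> pos_sphere X" "g \<in> pos_sphere X"
  shows "sup_norm X (\<lambda>x. f x - g x) = 1 \<longleftrightarrow>
    (\<exists>x\<in>topspace X. Re (f x) = 1 \<and> Re (g x) = 0 \<or> Re (f x) = 0 \<and> Re (g x) = 1)"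
proof -
  obtain x where x: "x \<in> topspace X" "sup_norm X (\<lambda>x. f x - g x) = \<bar>Re (f x) - Re (g x)\<bar>"
    "\<And>y. y \<in> topspace X \<Longrightarrow> \<bar>Re (f y) - Re (g y)\<bar> \<le> \<bar>Re (f x) - Re (g x)\<bar>"
    using pos_sphere_dist_attained[OF assms] by blast
  have b: "0 \<le> Re (f y)" "Re (f y) \<le> 1" "0 \<le> Re (g y)" "Re (g y) \<le> 1" if "y \<in> topspace X" for y
    using assms that pos_sphere_nonneg pos_sphere_le_1 by auto
  show ?thesis
  proof
    assume "sup_norm X (\<lambda>x. f x - g x) = 1"
    then have "\<bar>Re (f x) - Re (g x)\<bar> = 1" using x by simp
    then have "Re (f x) = 1 \<and> Re (g x) = 0 \<or> Re (f x) = 0 \<and> Re (g x) = 1"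
      using b[OF x(1)] by linarith
    with x(1) show "\<exists>x\<in>topspace X. Re (f x) = 1 \<and> Re (g x) = 0 \<or> Re (f x) = 0 \<and> Re (g x) = 1" ..
  next
    assume "\<exists>x\<in>topspace X. Re (f x) = 1 \<and> Re (g x) = 0 \<or> Re (f x) = 0 \<and> Re (g x) = 1"
    then obtain y where y: "y \<in> topspace X" "\<bar>Re (f y) - Re (g y)\<bar> = 1" by auto
    then show "sup_norm X (\<lambda>x. f x - g x) = 1"
      using x(2) x(3)[OF y(1)] b[OF x(1)] by linarith
  qed
qed

section \<open>Metric recognition of the constant function 1\<close>

lemma pos_sphere_eqI:
  assumes "f \<in> pos_sphere X" "g \<in> pos_sphere X"
    "\<And>x. x \<in> topspace X \<Longrightarrow> Re (f x) = Re (g x)"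
  shows "f = g"
proof (rule cont_fun_eqI)
  show "f x = g x" if "x \<in> topspace X" for x
    using assms(3)[OF that] pos_sphere_Im[OF assms(1) that] pos_sphere_Im[OF assms(2) that]
    by (simp add: complex_eq_iff)
qed (simp_all add: pos_sphere_cont_fun assms(1,2))

lemma one_in_pos_sphere:
  assumes "topspace X \<noteq> {}"
  shows "lift_real X (\<lambda>_. 1) \<in> pos_sphere X"
proof -
  obtain x where "x \<in> topspace X" using assms by blast
  then show ?thesis by (rule lift_real_in_pos_sphere[rotated 2]) auto
qed

text \<open>Since \<open>h\<close> fixes 1, a peak point of \<open>f\<close> remains one. This
  supplies the midpoints, squares and truncations used as test functions.\<close>

lemma pos_sphere_transform:
  assumes "f \<in> pos_sphere X" "continuous_on UNIV h" "h 1 = 1"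
    "\<And>t. 0 \<le> t \<Longrightarrow> t \<le> 1 \<Longrightarrow> 0 \<le> h t \<and> h t \<le> 1"
  shows "lift_real X (\<lambda>x. h (Re (f x))) \<in> pos_sphere X"
proof -
  obtain x where x: "x \<in> topspace X" "Re (f x) = 1"
    using assms(1) by (rule pos_sphere_peak)
  show ?thesis
  proof (rule lift_real_in_pos_sphere[OF _ _ x(1)])
    show "continuous_map X euclideanreal (\<lambda>x. h (Re (f x)))"
      using pos_sphere_continuous[OF assms(1)] assms(2) by (rule continuous_map_compose_continuous)
    show "0 \<le> h (Re (f z)) \<and> h (Re (f z)) \<le> 1" if "z \<in> topspace X" for z
      using pos_sphere_nonneg[OF assms(1) that] pos_sphere_le_1[OF assms(1) that] by (rule assms(4))
  qed (simp add: x(2) assms(3))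
qed

text \<open>
  The first condition, tested on \<open>2f - f\<^sup>2\<close> and \<open>f\<^sup>2\<close>, forces \<open>f\<close> to be \<open>0/1\<close>-valued.
  The second one, tested on \<open>1 - f\<close> (which is in the sphere unless \<open>f = 1\<close>),
  then produces the function \<open>1/2\<close>, which is not in the sphere.
\<close>

lemma pos_sphere_eq_one_iff:
  assumes f: "f \<in> pos_sphere X"
  shows "f = lift_real X (\<lambda>_. 1) \<longleftrightarrow>
    (\<forall>g\<in>pos_sphere X. \<forall>h\<in>pos_sphere X. \<forall>r.
       sup_norm X (\<lambda>x. f x - g x) \<le> r \<longrightarrow> sup_norm X (\<lambda>x. f x - h x) \<le> r \<longrightarrow>
       sup_norm X (\<lambda>x. g x - h x) \<le> r) \<and>
    (\<forall>g\<in>pos_sphere X. \<exists>h\<in>pos_sphere X.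
       sup_norm X (\<lambda>x. f x - h x) \<le> 1/2 \<and> sup_norm X (\<lambda>x. h x - g x) \<le> 1/2)"
    (is "_ \<longleftrightarrow> ?balls \<and> ?mid")
proof
  assume f1: "f = lift_real X (\<lambda>_. 1)"
  have ?balls
  proof (intro ballI allI impI)
    fix g h r assume gh: "g \<in> pos_sphere X" "h \<in> pos_sphere X"
      and "sup_norm X (\<lambda>x. f x - g x) \<le> r" "sup_norm X (\<lambda>x. f x - h x) \<le> r"
    then have "\<bar>1 - Re (g x)\<bar> \<le> r" "\<bar>1 - Re (h x)\<bar> \<le> r" if "x \<in> topspace X" for x
      using that f by (auto simp: pos_sphere_dist_le_iff f1)
    \<comment> \<open>Both values lie in the interval from \<open>1 - r\<close> to 1, which has
      length \<open>r\<close>.\<close>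
    then show "sup_norm X (\<lambda>x. g x - h x) \<le> r"
      using gh pos_sphere_le_1[of g] pos_sphere_le_1[of h]
      by (auto simp: pos_sphere_dist_le_iff) (smt (verit))
  qed
  moreover have ?mid
  proof
    fix g assume g: "g \<in> pos_sphere X"
    \<comment> \<open>The midpoint of \<open>g\<close> and the constant 1; as \<open>g\<close> takes
      values in [0, 1], it is within 1/2 of both.\<close>
    define h where "h = lift_real X (\<lambda>x. (1 + Re (g x)) / 2)"
    have h: "h \<in> pos_sphere X"
      unfolding h_def by (rule pos_sphere_transform[OF g, of "\<lambda>t. (1 + t) / 2"])
        (auto intro!: continuous_intros)
    have "\<bar>Re (f x) - Re (h x)\<bar> \<le> 1/2" "\<bar>Re (h x) - Re (g x)\<bar> \<le> 1/2" if "x \<in> topspace X" for x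
      using that pos_sphere_nonneg[OF g that] pos_sphere_le_1[OF g that]
      by (auto simp: f1 h_def abs_if field_simps)
    then show "\<exists>h\<in>pos_sphere X. sup_norm X (\<lambda>x. f x - h x) \<le> 1/2 \<and> sup_norm X (\<lambda>x. h x - g x) \<le> 1/2"
      using pos_sphere_dist_le_iff[OF f h] pos_sphere_dist_le_iff[OF h g] h by blast
  qed
  ultimately show "?balls \<and> ?mid" ..
next
  assume a: "?balls \<and> ?mid"
  \<comment> \<open>These are \<open>f + f (1 - f)\<close> and \<open>f - f (1 - f)\<close>: they
    lie symmetrically about \<open>f\<close>, so their mutual distance is twice their common
    distance to \<open>f\<close>.\<close>
  define g h where "g = lift_real X (\<lambda>x. 2 * Re (f x) - (Re (f x))\<^sup>2)"
    and "h = lift_real X (\<lambda>x. (Re (f x))\<^sup>2)"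
  have g: "g \<in> pos_sphere X"
    unfolding g_def
  proof (rule pos_sphere_transform[OF f])
    show "0 \<le> 2 * t - t\<^sup>2 \<and> 2 * t - t\<^sup>2 \<le> 1" if "0 \<le> t" "t \<le> 1" for t :: real
      using that mult_nonneg_nonneg[of t "2 - t"] zero_le_power2[of "1 - t"]
      by (auto simp: power2_eq_square algebra_simps)
  qed (auto intro!: continuous_intros)
  have h: "h \<in> pos_sphere X"
    unfolding h_def by (rule pos_sphere_transform[OF f, of "\<lambda>t. t\<^sup>2"])
      (auto intro!: continuous_intros power_le_one)
  have b: "0 \<le> Re (f x)" "Re (f x) \<le> 1" if "x \<in> topspace X" for x
    using pos_sphere_nonneg[OF f that] pos_sphere_le_1[OF f that] .
  obtain z where z: "z \<in> topspace X" "sup_norm X (\<lambda>x. f x - g x) = \<bar>Re (f z) - Re (g z)\<bar>"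
    using pos_sphere_dist_attained[OF f g] by blast
  define r where "r = \<bar>Re (f z) - Re (g z)\<bar>"
  have fg: "\<bar>Re (f x) - Re (g x)\<bar> = Re (f x) * (1 - Re (f x))"
    and fh: "\<bar>Re (f x) - Re (h x)\<bar> = Re (f x) * (1 - Re (f x))"
    and gh: "\<bar>Re (g x) - Re (h x)\<bar> = 2 * (Re (f x) * (1 - Re (f x)))" if "x \<in> topspace X" for x
    using that mult_nonneg_nonneg[of "Re (f x)" "1 - Re (f x)"] b[OF that]
    by (auto simp: g_def h_def power2_eq_square algebra_simps abs_if)
  have "sup_norm X (\<lambda>x. f x - g x) \<le> r" using z by (simp add: r_def)
  moreover from this have "sup_norm X (\<lambda>x. f x - h x) \<le> r"
    using f g h fg fh by (simp add: pos_sphere_dist_le_iff)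
  ultimately have gh': "sup_norm X (\<lambda>x. g x - h x) \<le> r" and fg': "sup_norm X (\<lambda>x. f x - g x) \<le> r"
    using a g h by blast+
  have "\<bar>Re (g z) - Re (h z)\<bar> \<le> r"
    using g h gh' z(1) by (rule pos_sphere_diff_le)
  \<comment> \<open>At the maximising point \<open>z\<close> the ball condition reads
    \<open>2 * r \<le> r\<close>.\<close>
  then have "r \<le> 0"
    using gh[OF z(1)] fg[OF z(1)] by (simp add: r_def)
  have "Re (f x) * (1 - Re (f x)) = 0" if "x \<in> topspace X" for x
  proof -
    have "\<bar>Re (f x) - Re (g x)\<bar> \<le> r"
      using f g fg' that by (rule pos_sphere_diff_le)
    with \<open>r \<le> 0\<close> fg[OF that] show ?thesis by linarith
  qed
  then have f01: "Re (f x) = 0 \<or> Re (f x) = 1" if "x \<in> topspace X" for x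
    using that by fastforce
  show "f = lift_real X (\<lambda>_. 1)"
  proof (rule ccontr)
    assume "f \<noteq> lift_real X (\<lambda>_. 1)"
    then obtain x where x: "x \<in> topspace X" "Re (f x) = 0"
      using pos_sphere_eqI[OF f one_in_pos_sphere[OF pos_sphere_topspace[OF f]]] f01
      by fastforce
    have "lift_real X (\<lambda>x. 1 - Re (f x)) \<in> pos_sphere X"
      using x b pos_sphere_continuous[OF f]
      by (intro lift_real_in_pos_sphere[of _ _ x]) (auto intro: continuous_map_diff)
    with a obtain k where k: "k \<in> pos_sphere X"
      "sup_norm X (\<lambda>x. f x - k x) \<le> 1/2"
      "sup_norm X (\<lambda>y. k y - lift_real X (\<lambda>x. 1 - Re (f x)) y) \<le> 1/2"
      "lift_real X (\<lambda>x. 1 - Re (f x)) \<in> pos_sphere X"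
      by blast
    \<comment> \<open>At a peak \<open>y\<close> of \<open>k\<close>, one of \<open>f\<close> and
      \<open>1 - f\<close> is 0, hence at distance 1 from \<open>k y\<close>.\<close>
    obtain y where y: "y \<in> topspace X" "Re (k y) = 1"
      using k(1) by (rule pos_sphere_peak)
    have "\<bar>Re (f y) - Re (k y)\<bar> \<le> 1/2" "\<bar>Re (k y) - (1 - Re (f y))\<bar> \<le> 1/2"
      using pos_sphere_diff_le[OF f k(1,2) y(1)] pos_sphere_diff_le[OF k(1,4,3) y(1)] y(1)
      by auto
    with f01[OF y(1)] y(2) show False by auto
  qed
qed

section \<open>Separation of points, zeros and peak sets\<close>

text \<open>\<open>pos_sphere X\<close> contains no function vanishing at \<open>x\<close> if \<open>X = {x}\<close>, hence \<open>C \<noteq> {}\<close>.\<close>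

lemma pos_sphere_Urysohn:
  assumes "Hausdorff_space X" "closedin X C" "C \<noteq> {}" "x \<in> topspace X" "x \<notin> C"
  obtains f where "f \<in> pos_sphere X" "Re (f x) = 0" "\<And>z. z \<in> C \<Longrightarrow> Re (f z) = 1"
proof -
  obtain u :: "'a \<Rightarrow> real" where u: "continuous_map X euclideanreal u"
    "\<And>z. z \<in> topspace X \<Longrightarrow> 0 \<le> u z \<and> u z \<le> 1" "u x = 0" "\<And>z. z \<in> C \<Longrightarrow> u z = 1"
    using Urysohn_compact_Hausdorff[OF compact assms(1,2,4,5)] by blast
  obtain c where "c \<in> C" using assms(3) by blast
  moreover have "C \<subseteq> topspace X" using assms(2) by (rule closedin_subset)
  ultimately show ?thesis
    using u assms(4) by (intro that[of "lift_real X u"] lift_real_in_pos_sphere[of _ _ c]) auto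
qed

text \<open>A sphere function that is 1 at \<open>x\<close> and 0 at \<open>y\<close> already
  violates the one-sided inequality.\<close>

lemma pos_sphere_separates:
  assumes "Hausdorff_space X" "x \<in> topspace X" "y \<in> topspace X"
    "\<And>f. f \<in> pos_sphere X \<Longrightarrow> Re (f x) \<le> Re (f y)"
  shows "x = y"
proof (rule ccontr)
  assume "x \<noteq> y"
  then obtain f where "f \<in> pos_sphere X" "Re (f y) = 0" "Re (f x) = 1"
    using pos_sphere_Urysohn[OF assms(1) closedin_Hausdorff_singleton[OF assms(1,2)] _ assms(3)]
    by blast
  with assms(4)[of f] show False by simp
qed

text \<open>The constant 1 never takes the value 0, so distance 1 from it can only be caused by a
  zero of \<open>f\<close>.\<close>

lemma inv_pos_sphere_iff_dist:
  assumes "f \<in> pos_sphere X"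
  shows "f \<in> inv_pos_sphere X \<longleftrightarrow> sup_norm X (\<lambda>x. lift_real X (\<lambda>_. 1) x - f x) \<noteq> 1"
  unfolding pos_sphere_dist_eq_1_iff[OF one_in_pos_sphere[OF pos_sphere_topspace[OF assms]] assms]
  using assms by (auto simp: inv_pos_sphere_def)

text \<open>For nowhere vanishing \<open>e\<close>, distance 1 to \<open>h\<close> means that
  \<open>h\<close> has a zero on the peak set of \<open>e\<close>. A larger peak set therefore keeps
  distance 1. Conversely, if \<open>f\<close> peaks at a point where \<open>g\<close> does not,
  Urysohn gives an \<open>h\<close> vanishing at that point and equal to 1 on the peak set of
  \<open>g\<close>.\<close>

lemma peak_subset_iff_dist:
  assumes "Hausdorff_space X" and f: "f \<in> inv_pos_sphere X" and g: "g \<in> inv_pos_sphere X"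
  shows "(\<forall>x\<in>topspace X. Re (f x) = 1 \<longrightarrow> Re (g x) = 1) \<longleftrightarrow>
    (\<forall>h\<in>pos_sphere X. sup_norm X (\<lambda>x. f x - h x) = 1 \<longrightarrow> sup_norm X (\<lambda>x. g x - h x) = 1)"
proof -
  have fs: "f \<in> pos_sphere X" and gs: "g \<in> pos_sphere X"
    using f g by (auto simp: inv_pos_sphere_def)
  have dist_inv: "sup_norm X (\<lambda>x. e x - h x) = 1 \<longleftrightarrow>
      (\<exists>x\<in>topspace X. Re (e x) = 1 \<and> Re (h x) = 0)"
    if "e \<in> inv_pos_sphere X" "h \<in> pos_sphere X" for e h
  proof -
    have "e \<in> pos_sphere X" "\<forall>x\<in>topspace X. Re (e x) \<noteq> 0"
      using that(1) by (auto simp: inv_pos_sphere_def)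
    then show ?thesis using pos_sphere_dist_eq_1_iff[OF _ that(2)] by blast
  qed
  show ?thesis
  proof
    assume "\<forall>x\<in>topspace X. Re (f x) = 1 \<longrightarrow> Re (g x) = 1"
    then show "\<forall>h\<in>pos_sphere X. sup_norm X (\<lambda>x. f x - h x) = 1 \<longrightarrow>
        sup_norm X (\<lambda>x. g x - h x) = 1"
      using dist_inv[OF f] dist_inv[OF g] by blast
  next
    assume a: "\<forall>h\<in>pos_sphere X. sup_norm X (\<lambda>x. f x - h x) = 1 \<longrightarrow>
        sup_norm X (\<lambda>x. g x - h x) = 1"
    show "\<forall>x\<in>topspace X. Re (f x) = 1 \<longrightarrow> Re (g x) = 1"
    proof (intro ballI impI, rule ccontr)
      fix x assume x: "x \<in> topspace X" "Re (f x) = 1" "Re (g x) \<noteq> 1"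
      define C where "C = {x \<in> topspace X. Re (g x) \<in> {1}}"
      have C: "closedin X C"
        unfolding C_def using pos_sphere_continuous[OF gs]
        by (rule closedin_continuous_map_preimage) simp
      obtain p where "p \<in> topspace X" "Re (g p) = 1" using gs by (rule pos_sphere_peak)
      then have "C \<noteq> {}" by (auto simp: C_def)
      moreover have "x \<notin> C" using x by (simp add: C_def)
      ultimately obtain h where h: "h \<in> pos_sphere X" "Re (h x) = 0" "\<And>z. z \<in> C \<Longrightarrow> Re (h z) = 1"
        using pos_sphere_Urysohn[OF assms(1) C _ x(1)] by blast
      then obtain z where "z \<in> topspace X" "Re (g z) = 1" "Re (h z) = 0"
        using a x dist_inv[OF f h(1)] dist_inv[OF g h(1)] by blast
      then show False using h(3)[of z] by (simp add: C_def)
    qed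
  qed
qed

end

subsection \<open>Isometries between positive spheres\<close>

text \<open>The hypotheses are symmetric under inversion; a locale allows each result to be reused
  with the two spaces exchanged.\<close>

locale pos_sphere_isometry =
  fixes X :: "'a topology" and Y :: "'b topology"
    and \<Phi> :: "('a \<Rightarrow> complex) \<Rightarrow> ('b \<Rightarrow> complex)"
  assumes compact_X: "compact_space X" and Hausdorff_X: "Hausdorff_space X"
    and compact_Y: "compact_space Y" and Hausdorff_Y: "Hausdorff_space Y"
    and bij: "bij_betw \<Phi> (pos_sphere X) (pos_sphere Y)"
    and dist: "\<And>f g. f \<in> pos_sphere X \<Longrightarrow> g \<in> pos_sphere X \<Longrightarrow>
           sup_norm Y (\<lambda>y. \<Phi> f y - \<Phi> g y) = sup_norm X (\<lambda>x. f x - g x)"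
begin

section \<open>The inverse isometry and transfer of metric properties\<close>

abbreviation \<Psi> :: "('b \<Rightarrow> complex) \<Rightarrow> ('a \<Rightarrow> complex)" where
  "\<Psi> \<equiv> inv_into (pos_sphere X) \<Phi>"

lemma in_pos_sphere: "f \<in> pos_sphere X \<Longrightarrow> \<Phi> f \<in> pos_sphere Y"
  using bij by (auto simp: bij_betw_def)

lemma inverse_in_pos_sphere: "g \<in> pos_sphere Y \<Longrightarrow> \<Psi> g \<in> pos_sphere X"
  using bij by (metis bij_betw_imp_surj_on inv_into_into)

lemma map_inverse: "g \<in> pos_sphere Y \<Longrightarrow> \<Phi> (\<Psi> g) = g"
  using bij by (metis bij_betw_inv_into_right)

lemma inverse_map: "f \<in> pos_sphere X \<Longrightarrow> \<Psi> (\<Phi> f) = f"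
  using bij by (metis bij_betw_inv_into_left)

lemma inverse_isometry: "pos_sphere_isometry Y X \<Psi>"
proof
  show "bij_betw \<Psi> (pos_sphere Y) (pos_sphere X)"
    using bij by (rule bij_betw_inv_into)
  show "sup_norm X (\<lambda>x. \<Psi> f x - \<Psi> g x) = sup_norm Y (\<lambda>y. f y - g y)"
    if "f \<in> pos_sphere Y" "g \<in> pos_sphere Y" for f g
    using dist[OF that[THEN inverse_in_pos_sphere]] that by (simp add: map_inverse)
qed (rule compact_X Hausdorff_X compact_Y Hausdorff_Y)+

text \<open>With this, any property phrased by distances and quantifiers over the sphere is
  invariant under \<Phi>; the characterisations of 1 and of peak set inclusion have that
  form.\<close>

lemma ball_pos_sphere_Y: "(\<forall>g\<in>pos_sphere Y. P g) \<longleftrightarrow> (\<forall>f\<in>pos_sphere X. P (\<Phi> f))"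
  using in_pos_sphere inverse_in_pos_sphere map_inverse by metis

lemma bex_pos_sphere_Y: "(\<exists>g\<in>pos_sphere Y. P g) \<longleftrightarrow> (\<exists>f\<in>pos_sphere X. P (\<Phi> f))"
  using in_pos_sphere inverse_in_pos_sphere map_inverse by metis

lemma map_one:
  assumes "topspace X \<noteq> {}"
  shows "\<Phi> (lift_real X (\<lambda>_. 1)) = lift_real Y (\<lambda>_. 1)"
proof -
  have 1: "lift_real X (\<lambda>_. 1) \<in> pos_sphere X"
    using compact_X assms by (rule one_in_pos_sphere)
  show ?thesis
    using pos_sphere_eq_one_iff[OF compact_X 1]
    by (simp add: pos_sphere_eq_one_iff[OF compact_Y in_pos_sphere[OF 1]]
        ball_pos_sphere_Y bex_pos_sphere_Y dist 1 cong: ball_cong bex_cong)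
qed

lemma inv_pos_sphere_iff:
  assumes "f \<in> pos_sphere X"
  shows "\<Phi> f \<in> inv_pos_sphere Y \<longleftrightarrow> f \<in> inv_pos_sphere X"
proof -
  have ne: "topspace X \<noteq> {}" using assms by (rule pos_sphere_topspace)
  then show ?thesis
    using assms dist[OF one_in_pos_sphere[OF compact_X ne] assms]
    by (simp add: inv_pos_sphere_iff_dist compact_X compact_Y in_pos_sphere map_one)
qed

lemma peak_subset_iff:
  assumes "f \<in> inv_pos_sphere X" "g \<in> inv_pos_sphere X"
  shows "(\<forall>y\<in>topspace Y. Re (\<Phi> f y) = 1 \<longrightarrow> Re (\<Phi> g y) = 1) \<longleftrightarrow>
    (\<forall>x\<in>topspace X. Re (f x) = 1 \<longrightarrow> Re (g x) = 1)"
proof -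
  have s: "f \<in> pos_sphere X" "g \<in> pos_sphere X"
    using assms by (auto simp: inv_pos_sphere_def)
  then show ?thesis
    using assms
    by (simp add: peak_subset_iff_dist compact_X compact_Y Hausdorff_X Hausdorff_Y
        inv_pos_sphere_iff ball_pos_sphere_Y dist cong: ball_cong)
qed

section \<open>From peak sets to points\<close>

text \<open>
  The peak sets of those invertible \<open>f\<close> for which \<open>\<Phi> f\<close> peaks at \<open>y\<close> have the
  finite intersection property: \<open>\<Phi> f\<close> and \<open>\<Phi> g\<close> have a common peak set containing \<open>y\<close>,
  namely that of their midpoint, and the order of peak sets is preserved.
\<close>

lemma common_peak_exists:
  assumes y: "y \<in> topspace Y"
  shows "\<exists>x\<in>topspace X. \<forall>f\<in>inv_pos_sphere X. Re (\<Phi> f y) = 1 \<longrightarrow> Re (f x) = 1"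
proof -
  define D where "D = {f \<in> inv_pos_sphere X. Re (\<Phi> f y) = 1}"
  define P where "P f = {x \<in> topspace X. Re (f x) \<in> {1}}" for f :: "'a \<Rightarrow> complex"
  have "lift_real Y (\<lambda>_. 1) \<in> pos_sphere Y"
    using one_in_pos_sphere[OF compact_Y] y by blast
  then have ne: "topspace X \<noteq> {}"
    using inverse_in_pos_sphere pos_sphere_topspace by blast
  then have one: "lift_real X (\<lambda>_. 1) \<in> D"
    using y one_in_pos_sphere[OF compact_X ne] by (auto simp: D_def inv_pos_sphere_def map_one)
  have meet: "\<exists>h\<in>D. P h \<subseteq> P f \<inter> P g" if fg: "f \<in> D" "g \<in> D" for f g
  proof -
    have inv: "f \<in> inv_pos_sphere X" "g \<in> inv_pos_sphere X"
      using fg by (auto simp: D_def)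
    then have s: "f \<in> pos_sphere X" "g \<in> pos_sphere X"
      by (auto simp: inv_pos_sphere_def)
    \<comment> \<open>An average of two values at most 1 is 1 only if both are; positivity of both
      keeps \<open>k\<close> free of zeros.\<close>
    define k where "k = lift_real Y (\<lambda>z. (Re (\<Phi> f z) + Re (\<Phi> g z)) / 2)"
    have b: "0 \<le> Re (\<Phi> e z)" "Re (\<Phi> e z) \<le> 1" if "e \<in> pos_sphere X" "z \<in> topspace Y" for e z
      using pos_sphere_nonneg[OF in_pos_sphere[OF that(1)] that(2)]
        pos_sphere_le_1[OF compact_Y in_pos_sphere[OF that(1)] that(2)] .
    have pos: "Re (\<Phi> e z) > 0" if "e \<in> inv_pos_sphere X" "z \<in> topspace Y" for e z
    proof -
      have e: "e \<in> pos_sphere X" using that(1) by (auto simp: inv_pos_sphere_def)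
      then have "Re (\<Phi> e z) \<noteq> 0"
        using that inv_pos_sphere_iff[OF e] by (auto simp: inv_pos_sphere_def)
      with b[OF e that(2)] show ?thesis by linarith
    qed
    have cont: "continuous_map Y euclideanreal (\<lambda>z. (Re (\<Phi> f z) + Re (\<Phi> g z)) / 2)"
      by (intro continuous_map_real_divide continuous_map_add pos_sphere_continuous in_pos_sphere s)
        auto
    have k: "k \<in> pos_sphere Y"
      unfolding k_def
    proof (rule lift_real_in_pos_sphere[OF cont _ y])
      show "0 \<le> (Re (\<Phi> f z) + Re (\<Phi> g z)) / 2 \<and> (Re (\<Phi> f z) + Re (\<Phi> g z)) / 2 \<le> 1"
        if "z \<in> topspace Y" for z
        using b[OF s(1) that] b[OF s(2) that] by simp
      show "(Re (\<Phi> f y) + Re (\<Phi> g y)) / 2 = 1" using fg by (simp add: D_def)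
    qed
    moreover have "Re (k z) \<noteq> 0" if "z \<in> topspace Y" for z
      using add_pos_pos[OF pos[OF inv(1) that] pos[OF inv(2) that]] that by (simp add: k_def)
    ultimately have "k \<in> inv_pos_sphere Y"
      by (simp add: inv_pos_sphere_def)
    then have hi: "\<Psi> k \<in> inv_pos_sphere X"
      using k inv_pos_sphere_iff[OF inverse_in_pos_sphere[OF k]] by (simp add: map_inverse)
    have "Re (\<Phi> f z) = 1 \<and> Re (\<Phi> g z) = 1" if "z \<in> topspace Y" "Re (k z) = 1" for z
      using that b[OF s(1) that(1)] b[OF s(2) that(1)] by (simp add: k_def)
    then have "P (\<Psi> k) \<subseteq> P f \<inter> P g"
      using peak_subset_iff[OF hi inv(1)] peak_subset_iff[OF hi inv(2)] k
      by (auto simp: P_def map_inverse)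
    moreover have "\<Psi> k \<in> D"
      using hi k y fg by (simp add: D_def map_inverse k_def)
    ultimately show ?thesis by blast
  qed
  \<comment> \<open>By \<open>meet\<close> the peak sets are directed downwards; the constant 1
    serves the empty family.\<close>
  have lower: "\<exists>h\<in>D. \<forall>f\<in>F. P h \<subseteq> P f" if "finite F" "F \<subseteq> D" for F
    using that
  proof (induction F rule: finite_induct)
    case empty
    then show ?case using one by blast
  next
    case (insert f F)
    then obtain h where "h \<in> D" "\<forall>f\<in>F. P h \<subseteq> P f" "f \<in> D" by blast
    moreover from this obtain k where "k \<in> D" "P k \<subseteq> P f \<inter> P h" using meet by blast
    ultimately show ?case by (intro bexI[of _ k]) auto
  qed
  have "\<Inter> (P ` D) \<noteq> {}"
  proof (rule compact_X[unfolded compact_space_fip, rule_format], intro conjI ballI allI impI)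
    show "closedin X C" if C: "C \<in> P ` D" for C
    proof -
      obtain f where f: "f \<in> pos_sphere X" "C = P f"
        using C by (auto simp: D_def inv_pos_sphere_def)
      then show ?thesis
        using closedin_continuous_map_preimage[OF pos_sphere_continuous[OF f(1)], of "{1}"]
        by (simp add: P_def)
    qed
    show "\<Inter> \<F> \<noteq> {}" if \<F>: "finite \<F> \<and> \<F> \<subseteq> P ` D" for \<F>
    proof -
      obtain F where "finite F" "F \<subseteq> D" "\<F> = P ` F"
        using \<F> by (meson finite_subset_image)
      moreover from this obtain h where "h \<in> D" "\<forall>f\<in>F. P h \<subseteq> P f"
        using lower by blast
      moreover have "P h \<noteq> {}"
        using \<open>h \<in> D\<close> pos_sphere_peak[OF compact_X, of h]
        by (auto simp: D_def inv_pos_sphere_def P_def)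
      ultimately show ?thesis by blast
    qed
  qed
  then obtain x where "x \<in> \<Inter> (P ` D)" by blast
  \<comment> \<open>That \<open>D\<close> contains the constant 1 puts \<open>x\<close> into the
    carrier: an empty intersection would be everything.\<close>
  then show ?thesis
    using one by (intro bexI[of _ x]) (auto simp: D_def P_def)
qed

text \<open>For \<open>0 \<le> s < f x\<close>, the truncation \<open>g\<close> of
  \<open>f + (1 - s)\<close> at 1 has no zeros since \<open>s < 1\<close>, peaks at
  \<open>x\<close>, and is within \<open>1 - s\<close> of \<open>f\<close>. As \<Phi> is isometric,
  \<open>\<Phi> f y\<close> falls short of \<open>\<Phi> g y = 1\<close> by at most
  \<open>1 - s\<close>.\<close>

lemma le_map_of_peaks:
  assumes x: "x \<in> topspace X" and y: "y \<in> topspace Y"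
    and peaks: "\<And>g. g \<in> inv_pos_sphere X \<Longrightarrow> Re (g x) = 1 \<Longrightarrow> Re (\<Phi> g y) = 1"
    and f: "f \<in> pos_sphere X"
  shows "Re (f x) \<le> Re (\<Phi> f y)"
proof (rule dense_le)
  fix s assume s: "s < Re (f x)"
  have fb: "0 \<le> Re (f z)" "Re (f z) \<le> 1" if "z \<in> topspace X" for z
    using f that pos_sphere_nonneg pos_sphere_le_1[OF compact_X] by auto
  show "s \<le> Re (\<Phi> f y)"
  proof (cases "s < 0")
    case True
    then show ?thesis using pos_sphere_nonneg[OF in_pos_sphere[OF f] y] by linarith
  next
    case False
    then have s0: "0 \<le> s" "s < 1" using s fb[OF x] by auto
    define g where "g = lift_real X (\<lambda>z. min 1 (Re (f z) + (1 - s)))"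
    have g: "g \<in> pos_sphere X"
      unfolding g_def by (rule pos_sphere_transform[OF compact_X f, of "\<lambda>t. min 1 (t + (1 - s))"])
        (use s0 in \<open>auto intro!: continuous_intros\<close>)
    have gi: "g \<in> inv_pos_sphere X"
      using g s0 fb by (fastforce simp: inv_pos_sphere_def g_def min_def)
    have "sup_norm X (\<lambda>z. f z - g z) \<le> 1 - s"
      unfolding pos_sphere_dist_le_iff[OF compact_X f g] using s0 fb by (auto simp: g_def)
    then have "\<bar>Re (\<Phi> f y) - Re (\<Phi> g y)\<bar> \<le> 1 - s"
      using dist[OF f g] y
      by (intro pos_sphere_diff_le[OF compact_Y in_pos_sphere[OF f] in_pos_sphere[OF g]]) simp_all
    moreover have "Re (\<Phi> g y) = 1"
      using s x by (intro peaks gi) (simp add: g_def)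
    ultimately show ?thesis by linarith
  qed
qed

text \<open>In terms of \<open>g = \<Phi> f\<close>, the common peak property of \<open>x\<close>
  says that \<open>\<Psi> g\<close> peaks at \<open>x\<close> whenever \<open>g\<close> peaks at
  \<open>y\<close>. This is the hypothesis of \<open>le_map_of_peaks\<close> for the inverse
  isometry.\<close>

lemma ex_point_map_le:
  assumes "y \<in> topspace Y"
  shows "\<exists>x\<in>topspace X. \<forall>f\<in>pos_sphere X. Re (\<Phi> f y) \<le> Re (f x)"
proof -
  interpret inv: pos_sphere_isometry Y X \<Psi> by (rule inverse_isometry)
  obtain x where x: "x \<in> topspace X" "\<forall>f\<in>inv_pos_sphere X. Re (\<Phi> f y) = 1 \<longrightarrow> Re (f x) = 1"
    using common_peak_exists[OF assms] by blast
  have "Re (\<Psi> g x) = 1" if "g \<in> inv_pos_sphere Y" "Re (g y) = 1" for g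
  proof -
    have "g \<in> pos_sphere Y" using that by (simp add: inv_pos_sphere_def)
    then show ?thesis using x that by (simp add: map_inverse inv.inv_pos_sphere_iff)
  qed
  then have "Re (\<Phi> f y) \<le> Re (f x)" if "f \<in> pos_sphere X" for f
    using inv.le_map_of_peaks[OF assms x(1) _ in_pos_sphere[OF that]] inverse_map[OF that] by simp
  with x(1) show ?thesis by blast
qed

lemma ex_point_eq:
  assumes y: "y \<in> topspace Y"
  shows "\<exists>x\<in>topspace X. \<forall>f\<in>pos_sphere X. \<Phi> f y = f x"
proof -
  interpret inv: pos_sphere_isometry Y X \<Psi> by (rule inverse_isometry)
  obtain x where x: "x \<in> topspace X" "\<And>f. f \<in> pos_sphere X \<Longrightarrow> Re (\<Phi> f y) \<le> Re (f x)"
    using ex_point_map_le[OF y] by blast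
  obtain y' where y': "y' \<in> topspace Y" "\<And>g. g \<in> pos_sphere Y \<Longrightarrow> Re (\<Psi> g x) \<le> Re (g y')"
    using inv.ex_point_map_le[OF x(1)] by blast
  have le: "Re (f x) \<le> Re (\<Phi> f y')" if "f \<in> pos_sphere X" for f
    using y'(2)[OF in_pos_sphere[OF that]] inverse_map[OF that] by simp
  \<comment> \<open>Surjectivity turns the chain from \<open>\<Phi> f y\<close> via
    \<open>f x\<close> to \<open>\<Phi> f y'\<close> into an inequality for every \<open>g\<close>
    in the sphere of \<open>Y\<close>.\<close>
  have "Re (g y) \<le> Re (g y')" if "g \<in> pos_sphere Y" for g
    using that x(2)[of "\<Psi> g"] le[of "\<Psi> g"] by (simp add: inverse_in_pos_sphere map_inverse)
  then have "y = y'"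
    using pos_sphere_separates[OF compact_Y Hausdorff_Y y y'(1)] by blast
  then have "\<Phi> f y = f x" if "f \<in> pos_sphere X" for f
    using le[OF that] x(2)[OF that] pos_sphere_of_real[OF that x(1)]
      pos_sphere_of_real[OF in_pos_sphere[OF that] y] by (metis antisym)
  with x(1) show ?thesis by blast
qed

lemma ex_homeomorphic_map:
  "\<exists>\<sigma>. homeomorphic_map Y X \<sigma> \<and> (\<forall>f\<in>pos_sphere X. \<forall>y\<in>topspace Y. \<Phi> f y = f (\<sigma> y))"
proof -
  interpret inv: pos_sphere_isometry Y X \<Psi> by (rule inverse_isometry)
  obtain \<sigma> where \<sigma>: "\<And>y. y \<in> topspace Y \<Longrightarrow> \<sigma> y \<in> topspace X"
    "\<And>y f. y \<in> topspace Y \<Longrightarrow> f \<in> pos_sphere X \<Longrightarrow> \<Phi> f y = f (\<sigma> y)"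
    using ex_point_eq by metis
  have "continuous_map Y X \<sigma>"
    unfolding continuous_map_def
  proof (intro conjI allI impI)
    show "\<sigma> \<in> topspace Y \<rightarrow> topspace X" using \<sigma>(1) by blast
    fix U assume U: "openin X U"
    show "openin Y {y \<in> topspace Y. \<sigma> y \<in> U}"
    proof (subst openin_subopen, intro ballI)
      fix y assume "y \<in> {y \<in> topspace Y. \<sigma> y \<in> U}"
      then have y: "y \<in> topspace Y" "\<sigma> y \<in> U" by auto
      obtain u :: "'a \<Rightarrow> real" where u: "continuous_map X euclideanreal u"
        "\<And>z. z \<in> topspace X \<Longrightarrow> 0 \<le> u z \<and> u z \<le> 1" "u (\<sigma> y) = 0"
        "\<And>z. z \<in> topspace X - U \<Longrightarrow> u z = 1"
        using Urysohn_compact_Hausdorff[OF compact_X Hausdorff_X, of "topspace X - U" "\<sigma> y"]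
          U y \<sigma>(1) by blast
      \<comment> \<open>\<open>f\<close> is 1 at \<open>\<sigma> y\<close> and 0 off
        \<open>U\<close>, so \<open>\<Phi> f\<close> is positive on an open neighbourhood of
        \<open>y\<close> that \<sigma> maps into \<open>U\<close>. The peak at
        \<open>\<sigma> y\<close> keeps \<open>f\<close> in the sphere even if \<open>U\<close> is
        everything.\<close>
      define f where "f = lift_real X (\<lambda>x. 1 - u x)"
      have f: "f \<in> pos_sphere X"
        unfolding f_def using u \<sigma>(1)[OF y(1)]
        by (intro lift_real_in_pos_sphere[of _ _ "\<sigma> y"]) (auto intro: continuous_map_diff)
      let ?V = "{z \<in> topspace Y. Re (\<Phi> f z) \<in> {0<..}}"
      have "openin Y ?V"
        using pos_sphere_continuous[OF in_pos_sphere[OF f]]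
        by (rule openin_continuous_map_preimage) simp
      moreover have "Re (\<Phi> f z) = 1 - u (\<sigma> z)" if "z \<in> topspace Y" for z
        using that \<sigma> f by (simp add: f_def)
      then have "y \<in> ?V" "?V \<subseteq> {y \<in> topspace Y. \<sigma> y \<in> U}"
        using y u(3) u(4) \<sigma>(1) by fastforce+
      ultimately show "\<exists>T. openin Y T \<and> y \<in> T \<and> T \<subseteq> {y \<in> topspace Y. \<sigma> y \<in> U}"
        by blast
    qed
  qed
  moreover have "inj_on \<sigma> (topspace Y)"
  proof (rule inj_onI)
    fix y y' assume y: "y \<in> topspace Y" "y' \<in> topspace Y" "\<sigma> y = \<sigma> y'"
    \<comment> \<open>Every \<open>g\<close> is some \<open>\<Phi> f\<close>, so its value at a
      point depends only on the image under \<sigma>.\<close>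
    have eq: "g y = g y'" if "g \<in> pos_sphere Y" for g
      using \<sigma>(2)[OF y(1) inverse_in_pos_sphere[OF that]] \<sigma>(2)[OF y(2) inverse_in_pos_sphere[OF that]]
      by (simp add: y(3) map_inverse[OF that])
    show "y = y'"
      by (intro pos_sphere_separates[OF compact_Y Hausdorff_Y y(1,2)])
        (rule eq_refl[OF arg_cong[OF eq]])
  qed
  moreover have "topspace X \<subseteq> \<sigma> ` topspace Y"
  proof
    fix x assume x: "x \<in> topspace X"
    \<comment> \<open>The point that the inverse isometry assigns to \<open>x\<close>; no sphere
      function distinguishes \<open>x\<close> from \<open>\<sigma> y\<close>.\<close>
    then obtain y where y: "y \<in> topspace Y" "\<And>g. g \<in> pos_sphere Y \<Longrightarrow> \<Psi> g x = g y"
      using inv.ex_point_eq by blast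
    have eq: "f x = f (\<sigma> y)" if "f \<in> pos_sphere X" for f
      using \<sigma>(2)[OF y(1) that] y(2)[OF in_pos_sphere[OF that]] by (simp add: inverse_map[OF that])
    have "x = \<sigma> y"
      by (intro pos_sphere_separates[OF compact_X Hausdorff_X x \<sigma>(1)[OF y(1)]])
        (rule eq_refl[OF arg_cong[OF eq]])
    with y(1) show "x \<in> \<sigma> ` topspace Y" by blast
  qed
  ultimately have "homeomorphic_map Y X \<sigma>"
    using \<sigma>(1) by (intro continuous_imp_homeomorphic_map compact_Y Hausdorff_X) auto
  with \<sigma>(2) show ?thesis by blast
qed

end

subsection \<open>Extension to the whole algebra\<close>

lemma star_isomorphism_in_cont_fun:
  "star_isomorphism X Y T \<Longrightarrow> f \<in> cont_fun X \<Longrightarrow> T f \<in> cont_fun Y"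
  unfolding star_isomorphism_def by (blast dest: bij_betwE)

lemma star_isomorphism_composition:
  assumes "homeomorphic_map Y X \<sigma>"
  shows "star_isomorphism X Y (\<lambda>f\<in>cont_fun X. \<lambda>y\<in>topspace Y. f (\<sigma> y))"
proof -
  let ?T = "\<lambda>f\<in>cont_fun X. \<lambda>y\<in>topspace Y. f (\<sigma> y)"
  obtain \<tau> where "homeomorphic_maps Y X \<sigma> \<tau>"
    using assms homeomorphic_map_maps by blast
  then have \<sigma>: "continuous_map Y X \<sigma>" "\<And>y. y \<in> topspace Y \<Longrightarrow> \<sigma> y \<in> topspace X"
      "\<And>y. y \<in> topspace Y \<Longrightarrow> \<tau> (\<sigma> y) = y"
    and \<tau>: "continuous_map X Y \<tau>" "\<And>x. x \<in> topspace X \<Longrightarrow> \<tau> x \<in> topspace Y"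
      "\<And>x. x \<in> topspace X \<Longrightarrow> \<sigma> (\<tau> x) = x"
    by (auto simp: homeomorphic_maps_def continuous_map_def)
  \<comment> \<open>Stated for arbitrary spaces, so as to apply to both \<sigma> and \<tau>.\<close>
  have comp: "(\<lambda>y\<in>topspace B. f (\<rho> y)) \<in> cont_fun B"
    if "f \<in> cont_fun A" "continuous_map B A \<rho>" for A :: "'x topology" and B :: "'y topology" and f \<rho>
    using restrict_in_cont_fun[OF continuous_map_compose[OF that(2)]] that(1)
    by (simp add: cont_fun_def o_def)
  have "bij_betw ?T (cont_fun X) (cont_fun Y)"
  proof (rule bij_betw_byWitness[where f' = "\<lambda>g. \<lambda>x\<in>topspace X. g (\<tau> x)"])
    show "\<forall>f\<in>cont_fun X. (\<lambda>x\<in>topspace X. ?T f (\<tau> x)) = f"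
      using \<tau> by (auto intro!: extensionalityI[of _ "topspace X"] simp: cont_fun_def)
    have b: "(\<lambda>x\<in>topspace X. g (\<tau> x)) \<in> cont_fun X" if "g \<in> cont_fun Y" for g
      using that \<tau>(1) by (rule comp)
    then show "\<forall>g\<in>cont_fun Y. ?T (\<lambda>x\<in>topspace X. g (\<tau> x)) = g"
      using \<sigma> by (auto intro!: extensionalityI[of _ "topspace Y"] simp: cont_fun_def)
    show "?T ` cont_fun X \<subseteq> cont_fun Y" using comp[OF _ \<sigma>(1)] by auto
    show "(\<lambda>g. \<lambda>x\<in>topspace X. g (\<tau> x)) ` cont_fun Y \<subseteq> cont_fun X" using b by auto
  qed
  then show ?thesis
    using \<sigma>(2)
    by (auto simp: star_isomorphism_def cont_fun_add cont_fun_mult cont_fun_scale cont_fun_cnj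
        intro!: restrict_ext)
qed

section \<open>Uniqueness of the extension\<close>

lemma real_eq_affine_pos_sphere:
  assumes "compact_space X" "topspace X \<noteq> {}" "continuous_map X euclideanreal u"
  obtains c m v where "v \<in> pos_sphere X"
    "\<And>x. x \<in> topspace X \<Longrightarrow> u x = c * Re (v x) + m"
proof -
  obtain a where a: "a \<in> topspace X" "\<And>x. x \<in> topspace X \<Longrightarrow> u x \<le> u a"
    using compact_space_attains_sup[OF assms] by blast
  obtain b where b: "b \<in> topspace X" "\<And>x. x \<in> topspace X \<Longrightarrow> - u x \<le> - u b"
    using compact_space_attains_sup[OF assms(1,2) continuous_map_minus[OF assms(3)]] by blast
  \<comment> \<open>The added 1 keeps \<open>c\<close> positive for constant \<open>u\<close>; the
    rescaled function has minimum \<open>1 / c\<close> and maximum 1.\<close>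
  define c where "c = u a - u b + 1"
  have c: "c > 0" using a(2)[OF b(1)] by (simp add: c_def)
  have "lift_real X (\<lambda>x. (u x - u b + 1) / c) \<in> pos_sphere X"
  proof (rule lift_real_in_pos_sphere[OF _ _ a(1)])
    show "continuous_map X euclideanreal (\<lambda>x. (u x - u b + 1) / c)"
      using assms(3) by (rule continuous_map_compose_continuous[of X u "\<lambda>t. (t - u b + 1) / c"])
        (use c in \<open>auto intro!: continuous_intros\<close>)
    show "0 \<le> (u x - u b + 1) / c \<and> (u x - u b + 1) / c \<le> 1" if "x \<in> topspace X" for x
      using a(2)[OF that] b(2)[OF that] c by (auto simp: c_def)
    show "(u a - u b + 1) / c = 1" using c by (simp add: c_def)
  qed
  moreover have "u x = c * ((u x - u b + 1) / c) + (u b - 1)" for x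
    using c by simp
  ultimately show ?thesis using that[of _ c "u b - 1"] by simp
qed

text \<open>Real and imaginary part are rescaled separately. As the constant 1 is in the sphere, the
  sphere spans \<open>C(X)\<close>.\<close>

lemma cont_fun_eq_combination:
  assumes "compact_space X" "topspace X \<noteq> {}" "f \<in> cont_fun X"
  obtains a b c v w where "v \<in> pos_sphere X" "w \<in> pos_sphere X"
    "\<And>x. x \<in> topspace X \<Longrightarrow> f x = a * v x + (b * w x + c)"
proof -
  have f: "continuous_map X euclidean f" using assms(3) by (simp add: cont_fun_def)
  obtain a m v where v: "v \<in> pos_sphere X" "\<And>x. x \<in> topspace X \<Longrightarrow> Re (f x) = a * Re (v x) + m"
    by (rule real_eq_affine_pos_sphere[OF assms(1,2) continuous_map_Re[OF f]]) blast
  obtain b n w where w: "w \<in> pos_sphere X" "\<And>x. x \<in> topspace X \<Longrightarrow> Im (f x) = b * Re (w x) + n"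
    by (rule real_eq_affine_pos_sphere[OF assms(1,2) continuous_map_Im[OF f]]) blast
  have "f x = of_real a * v x + ((\<i> * of_real b) * w x + Complex m n)" if "x \<in> topspace X" for x
  proof -
    have "Im (v x) = 0" "Im (w x) = 0"
      using pos_sphere_Im[OF v(1) that] pos_sphere_Im[OF w(1) that] .
    then show ?thesis using v(2)[OF that] w(2)[OF that] by (simp add: complex_eq_iff)
  qed
  with v(1) w(1) show ?thesis by (rule that)
qed

lemma star_isomorphism_determined:
  assumes "compact_space X" "topspace X \<noteq> {}" "star_isomorphism X Y S" "star_isomorphism X Y T"
    and eq: "\<And>f. f \<in> pos_sphere X \<Longrightarrow> S f = T f" and f: "f \<in> cont_fun X"
  shows "S f = T f"
proof -
  obtain a b c v w where vw: "v \<in> pos_sphere X" "w \<in> pos_sphere X"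
    "\<And>x. x \<in> topspace X \<Longrightarrow> f x = a * v x + (b * w x + c)"
    by (rule cont_fun_eq_combination[OF assms(1,2) f]) blast
  let ?sm = "\<lambda>c (g :: 'a \<Rightarrow> complex). \<lambda>x\<in>topspace X. c * g x"
  let ?add = "\<lambda>(g :: 'a \<Rightarrow> complex) h. \<lambda>x\<in>topspace X. g x + h x"
  let ?one = "lift_real X (\<lambda>_. 1)"
  have one: "?one \<in> pos_sphere X" using assms(1,2) by (rule one_in_pos_sphere)
  have sm: "?sm c g \<in> cont_fun X" if "g \<in> cont_fun X" for c g
    using that by (rule cont_fun_scale)
  have add: "?add g h \<in> cont_fun X" if "g \<in> cont_fun X" "h \<in> cont_fun X" for g h
    using that by (rule cont_fun_add)
  have f_eq: "f = ?add (?sm a v) (?add (?sm b w) (?sm c ?one))"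
    using f vw(3) by (auto intro!: extensionalityI[of _ "topspace X"]
        simp: cont_fun_def lift_real_def)
  have sm_eq: "S (?sm c g) = T (?sm c g)" if "g \<in> pos_sphere X" for c g
    using assms(3,4) pos_sphere_cont_fun[OF that] eq[OF that] by (simp add: star_isomorphism_def)
  have add_eq: "S (?add g h) = T (?add g h)"
    if "g \<in> cont_fun X" "h \<in> cont_fun X" "S g = T g" "S h = T h" for g h
    using assms(3,4) that by (simp add: star_isomorphism_def)
  show ?thesis
    unfolding f_eq by (intro add_eq sm_eq add sm pos_sphere_cont_fun vw(1,2) one)
qed

text \<open>Extensionality of \<open>T\<close> fixes its values off \<open>cont_fun X\<close>, so
  that uniqueness is equality of HOL functions.\<close>

theorem theorem14:
  fixes X :: "'a topology" and Y :: "'b topology"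
    and \<Phi> :: "('a \<Rightarrow> complex) \<Rightarrow> ('b \<Rightarrow> complex)"
  assumes "compact_space X" and "Hausdorff_space X"
    and "compact_space Y" and "Hausdorff_space Y"
    and "bij_betw \<Phi> (pos_sphere X) (pos_sphere Y)"
    and "\<And>f g. f \<in> pos_sphere X \<Longrightarrow> g \<in> pos_sphere X \<Longrightarrow>
           sup_norm Y (\<lambda>y. \<Phi> f y - \<Phi> g y) = sup_norm X (\<lambda>x. f x - g x)"
  shows "(\<exists>!T. T \<in> extensional (cont_fun X) \<and> star_isomorphism X Y T \<and>
               (\<forall>f\<in>pos_sphere X. T f = \<Phi> f)) \<and>
         (\<exists>\<sigma>. homeomorphic_map Y X \<sigma> \<and>
               (\<forall>f\<in>pos_sphere X. \<forall>y\<in>topspace Y. \<Phi> f y = f (\<sigma> y)))"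
proof -
  interpret pos_sphere_isometry X Y \<Phi>
    using assms by unfold_locales
  obtain \<sigma> where \<sigma>: "homeomorphic_map Y X \<sigma>"
    "\<forall>f\<in>pos_sphere X. \<forall>y\<in>topspace Y. \<Phi> f y = f (\<sigma> y)"
    using ex_homeomorphic_map by blast
  define T where "T = (\<lambda>f\<in>cont_fun X. \<lambda>y\<in>topspace Y. f (\<sigma> y))"
  have T: "star_isomorphism X Y T"
    unfolding T_def using \<sigma>(1) by (rule star_isomorphism_composition)
  have T_ext: "T \<in> extensional (cont_fun X)" by (simp add: T_def)
  have T_eq: "T f = \<Phi> f" if "f \<in> pos_sphere X" for f
  proof (rule cont_fun_eqI)
    show "T f \<in> cont_fun Y" "\<Phi> f \<in> cont_fun Y"
      using that by (simp_all add: star_isomorphism_in_cont_fun[OF T] pos_sphere_cont_fun in_pos_sphere)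
    show "T f y = \<Phi> f y" if "y \<in> topspace Y" for y
      using that \<sigma>(2) \<open>f \<in> pos_sphere X\<close> by (simp add: T_def pos_sphere_cont_fun)
  qed
  have unique: "S = T" if S: "S \<in> extensional (cont_fun X)" "star_isomorphism X Y S"
    "\<forall>f\<in>pos_sphere X. S f = \<Phi> f" for S
  proof (rule extensionalityI[OF S(1) T_ext])
    fix f assume f: "f \<in> cont_fun X"
    show "S f = T f"
    proof (cases "topspace X = {}")
      \<comment> \<open>Here the sphere is empty and agreement on it says nothing, but \<sigma>
        forces \<open>Y\<close> to be empty too, and then \<open>cont_fun Y\<close> has at most one
        element.\<close>
      case True
      then have "topspace Y = {}"
        using homeomorphic_imp_surjective_map[OF \<sigma>(1)] by blast
      then show ?thesis
        using star_isomorphism_in_cont_fun[OF S(2) f] star_isomorphism_in_cont_fun[OF T f]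
        by (intro cont_fun_eqI[of _ Y]) auto
    next
      case False
      show ?thesis
        by (rule star_isomorphism_determined[OF assms(1) False S(2) T _ f]) (simp add: T_eq S(3))
    qed
  qed
  have "\<exists>!T. T \<in> extensional (cont_fun X) \<and> star_isomorphism X Y T \<and>
      (\<forall>f\<in>pos_sphere X. T f = \<Phi> f)"
    by (rule ex1I[of _ T]) (use T T_ext T_eq unique in blast)+
  with \<sigma> show ?thesis by blast
qed

end
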